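(* The numbers $\phi(k,n;J,O)$ satisfy $\phi(k,n;J,O)=\phi(n,k;J,O)$ for all $k,n\ge1$ and are given as follows. (1) For all $n\ge1$: $\phi(1,n;J,O)=2^n$ and $\phi(2,n;J,O)=(n^2+3n+4)2^{n-2}$. (2) $\phi(3,3;J,O)=156$, $\phi(3,4;J,O)=408$, $\phi(4,4;J,O)=840$, and $\phi(3,5;J,O)=\phi(3,6;J,O)=\phi(4,5;J,O)=\phi(4,6;J,O)=720$. (3) $\phi(k,n;J,O)=0$ for all $k,n\ge5$; $\phi(3,n;J,O)=\phi(4,n;J,O)=0$ for all $n\ge7$; $\phi(5,n;J,O)=\phi(6,n;J,O)=0$ for all $n\ge5$; and $\phi(k,n;J,O)=0$ for all $k\ge7$ and $n\ge3$.
   Context: A $(0,1)$-matrix is a matrix with all entries in $\{0,1\}$. A $2\times2$ submatrix of a matrix is obtained by choosing two rows $i_1<i_2$ and two columns $j_1<j_2$. Let $J=\begin{pmatrix}1&1\\1&1\end{pmatrix}$ and $O=\begin{pmatrix}0&0\\0&0\end{pmatrix}$. For $k,n\ge1$, $\phi(k,n;J,O)$ is the number of $k\times n$ $(0,1)$-matrices having no $2\times2$ submatrix equal to $J$ or $O$. *)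

theory Defs
  imports Complex_Main "Jordan_Normal_Form.DL_Submatrix"
begin

definition zero_one_matrices :: "nat \<Rightarrow> nat \<Rightarrow> nat mat set" where
  "zero_one_matrices k n = {A \<in> carrier_mat k n. elements_mat A \<subseteq> {0, 1}}"

(* Rows and columns are numbered from 0; submatrix takes the sets of chosen row and column
   indices and keeps their order. *)
definition has_2x2_submatrix :: "'a mat \<Rightarrow> 'a mat \<Rightarrow> bool" where
  "has_2x2_submatrix A B \<longleftrightarrow>
     (\<exists>i1 i2 j1 j2. i1 < i2 \<and> i2 < dim_row A \<and> j1 < j2 \<and> j2 < dim_col A \<and>
        submatrix A {i1, i2} {j1, j2} = B)"

definition J_mat :: "nat mat" where
  "J_mat = mat 2 2 (\<lambda>_. 1)"

definition O_mat :: "nat mat" where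
  "O_mat = mat 2 2 (\<lambda>_. 0)"

definition phi :: "nat \<Rightarrow> nat \<Rightarrow> nat mat \<Rightarrow> nat mat \<Rightarrow> nat" where
  "phi k n P Q =
     card {A \<in> zero_one_matrices k n. \<not> has_2x2_submatrix A P \<and> \<not> has_2x2_submatrix A Q}"

end

theory Submission
  imports Defs
begin

text \<open>
  A matrix contains \<open>J\<close> or \<open>O\<close> exactly if two of its columns carry the same constant pair in the
  same two rows. The forbidden configurations thus constrain the columns only pairwise, and
  \<open>\<phi>(k,n;J,O)\<close> is the number of length-\<open>n\<close> sequences of 0/1 columns of height \<open>k\<close>, every two of
  which are compatible: as aligned words, they share at most one 1 and at most one 0
  (\<open>phi_eq_count_seqs\<close>). Choosing the first column of such a sequence leaves a sequence of the same
  kind over the columns compatible with it, so these sequences are counted by a recursion that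
  shrinks the list of candidate columns (\<open>card_sorted_wrt_eq_count_seqs\<close>).

  For heights 1 and 2 the recursion has a closed form. All columns of height 1 are compatible. For
  height 2, the columns 01 and 10 are compatible with everything, while 00 and 11 are compatible
  with everything but themselves, so that each of the two occurs at most once; this gives
  \<open>2^n + 2 n 2^(n-1) + n (n-1) 2^(n-2)\<close>. From height 3 on, every column contains a constant pair and
  hence is not compatible with itself. A sequence is then a clique in a graph on \<open>2^k\<close> vertices
  together with an ordering of it. At the sizes at issue there are so few of them that unfolding the
  recursion enumerates them all.

  The zeros propagate from the two sizes (3,7) and (5,5) to all larger ones, since a sequence stays
  admissible when it is truncated and since transposition makes \<open>\<phi>\<close> symmetric. That \<open>\<phi>\<close> vanishes
  at these two sizes, which the enumeration confirms, is a matter of counting constant pairs, of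
  which each pair of rows admits one of ones and one of zeros. A column of height 3 uses at least
  one of the 6 available constant pairs, so 7 columns are too many. A column of height 5 uses at
  least 4 of the 20 available, so 5 columns would use each of them exactly once; but then each
  column would have 1 or 3 constant pairs of ones, and five odd numbers do not sum to 10.
\<close>

section \<open>Counting pairwise related sequences\<close>

fun count_seqs :: "('a \<Rightarrow> 'a \<Rightarrow> bool) \<Rightarrow> nat \<Rightarrow> 'a list \<Rightarrow> nat" where
  "count_seqs R 0 cs = 1"
| "count_seqs R (Suc n) cs = (\<Sum>c\<leftarrow>cs. count_seqs R n (filter (R c) cs))"

text \<open>
  Splitting by the head \<open>c\<close>: the tail must lie in \<open>{d \<in> set cs. R c d}\<close> and is otherwise subject to the
  same condition.
\<close>

lemma card_sorted_wrt_eq_count_seqs: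
  assumes "distinct cs"
  shows "card {xs. length xs = n \<and> set xs \<subseteq> set cs \<and> sorted_wrt R xs} = count_seqs R n cs"
  using assms
proof (induction n arbitrary: cs)
  case 0
  have "{xs. length xs = 0 \<and> set xs \<subseteq> set cs \<and> sorted_wrt R xs} = {[]}"
    by auto
  then show ?case by simp
next
  case (Suc n)
  let ?S = "\<lambda>n cs. {xs. length xs = n \<and> set xs \<subseteq> set cs \<and> sorted_wrt R xs}"
  have fin: "finite {xs. length xs = n \<and> set xs \<subseteq> D \<and> sorted_wrt R xs}" if "finite D" for D
    by (rule finite_subset[OF _ finite_lists_length_eq[OF that, of n]]) auto
  have split: "?S (Suc n) cs = (\<Union>c\<in>set cs. (#) c ` ?S n (filter (R c) cs))"
    by (auto simp: length_Suc_conv image_iff)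
  have "card (?S (Suc n) cs) = (\<Sum>c\<in>set cs. card ((#) c ` ?S n (filter (R c) cs)))"
    unfolding split by (rule card_UN_disjoint) (use fin in auto)
  also have "\<dots> = (\<Sum>c\<in>set cs. count_seqs R n (filter (R c) cs))"
    by (simp only: card_image[OF inj_on_Cons1] Suc.IH[OF distinct_filter[OF Suc.prems]])
  also have "\<dots> = count_seqs R (Suc n) cs"
    using Suc.prems by (simp add: sum_list_distinct_conv_sum_set)
  finally show ?case .
qed

lemma count_seqs_eq_0_mono:
  assumes "distinct cs" "count_seqs R m cs = 0" "m \<le> n"
  shows "count_seqs R n cs = 0"
proof -
  let ?S = "\<lambda>n. {xs. length xs = n \<and> set xs \<subseteq> set cs \<and> sorted_wrt R xs}"
  have "finite (?S m)"
    by (rule finite_subset[OF _ finite_lists_length_eq[of "set cs" m]]) auto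
  then have empty: "?S m = {}"
    using assms card_sorted_wrt_eq_count_seqs[of cs m R] by simp
  have "take m xs \<in> ?S m" if "xs \<in> ?S n" for xs
    using that assms(3) set_take_subset[of m xs] by (auto intro: sorted_wrt_take)
  then have "?S n = {}"
    using empty by blast
  then show ?thesis
    using card_sorted_wrt_eq_count_seqs[OF assms(1), of n R] by (metis card.empty)
qed

section \<open>Compatible columns\<close>

text \<open>
  Counting letters of the zipped word, instead of quantifying over pairs of positions, makes the
  condition fit for symbolic evaluation.
\<close>

definition compatible :: "bool list \<Rightarrow> bool list \<Rightarrow> bool" where
  "compatible xs ys \<longleftrightarrow> (\<forall>b. count_list (zip xs ys) (b, b) \<le> 1)"

lemma count_list_le_1_iff:
  "count_list zs z \<le> 1 \<longleftrightarrow> (\<forall>i j. i < j \<longrightarrow> j < length zs \<longrightarrow> \<not> (zs ! i = z \<and> zs ! j = z))"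
proof -
  have "count_list zs z = card {i. i < length zs \<and> zs ! i = z}"
    by (simp add: count_list_eq_length_filter length_filter_conv_card eq_commute)
  moreover have "finite {i. i < length zs \<and> zs ! i = z}"
    by simp
  ultimately have "count_list zs z \<le> 1 \<longleftrightarrow>
      (\<forall>i j. i < length zs \<and> zs ! i = z \<longrightarrow> j < length zs \<and> zs ! j = z \<longrightarrow> i = j)"
    by (simp add: card_le_Suc0_iff_eq)
  also have "\<dots> \<longleftrightarrow> (\<forall>i j. i < j \<longrightarrow> j < length zs \<longrightarrow> \<not> (zs ! i = z \<and> zs ! j = z))"
  proof (intro iffI allI impI)
    fix i j
    assume *: "\<forall>i j. i < j \<longrightarrow> j < length zs \<longrightarrow> \<not> (zs ! i = z \<and> zs ! j = z)"
      and "i < length zs \<and> zs ! i = z" "j < length zs \<and> zs ! j = z"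
    then show "i = j"
      by (cases i j rule: linorder_cases) blast+
  qed (metis less_irrefl order_less_trans)
  finally show ?thesis .
qed

lemma compatible_iff:
  assumes "length xs = k" "length ys = k"
  shows "compatible xs ys \<longleftrightarrow>
    (\<forall>i1 i2. i1 < i2 \<longrightarrow> i2 < k \<longrightarrow> \<not> (xs ! i1 = xs ! i2 \<and> ys ! i1 = xs ! i1 \<and> ys ! i2 = xs ! i1))"
  unfolding compatible_def count_list_le_1_iff using assms by auto

section \<open>Matrices as sequences of columns\<close>

lemma pick_doubleton:
  assumes "a < b"
  shows "pick {a, b} 0 = a" "pick {a, b} (Suc 0) = b"
proof -
  show "pick {a, b} 0 = a"
    using assms by (auto intro!: Least_equality)
  then show "pick {a, b} (Suc 0) = b"
    using assms by (auto intro!: Least_equality simp del: pick.simps(1) simp: pick.simps(2))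
qed

lemma submatrix_eq_const_iff:
  assumes "i1 < i2" "i2 < dim_row A" "j1 < j2" "j2 < dim_col A"
  shows "submatrix A {i1, i2} {j1, j2} = mat 2 2 (\<lambda>_. c) \<longleftrightarrow>
    A $$ (i1, j1) = c \<and> A $$ (i2, j1) = c \<and> A $$ (i1, j2) = c \<and> A $$ (i2, j2) = c"
proof -
  have "{i. i < dim_row A \<and> i \<in> {i1, i2}} = {i1, i2}"
    and "{j. j < dim_col A \<and> j \<in> {j1, j2}} = {j1, j2}"
    using assms by auto
  then have "submatrix A {i1, i2} {j1, j2} =
      mat 2 2 (\<lambda>(i, j). A $$ (pick {i1, i2} i, pick {j1, j2} j))"
    using assms by (simp add: submatrix_def numeral_2_eq_2)
  then show ?thesis
    using pick_doubleton[OF assms(1)] pick_doubleton[OF assms(3)]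
    by (auto simp: mat_eq_iff less_2_cases_iff)
qed

abbreviation avoiding_matrices :: "nat \<Rightarrow> nat \<Rightarrow> nat mat set" where
  "avoiding_matrices k n \<equiv>
    {A \<in> zero_one_matrices k n. \<not> has_2x2_submatrix A J_mat \<and> \<not> has_2x2_submatrix A O_mat}"

lemma zero_one_matrices_iff:
  "A \<in> zero_one_matrices k n \<longleftrightarrow>
    A \<in> carrier_mat k n \<and> (\<forall>i<k. \<forall>j<n. A $$ (i, j) = 0 \<or> A $$ (i, j) = 1)"
proof -
  have "elements_mat A \<subseteq> {0, 1} \<longleftrightarrow> (\<forall>i<k. \<forall>j<n. A $$ (i, j) = 0 \<or> A $$ (i, j) = 1)"
    if A: "A \<in> carrier_mat k n"
  proof
    assume "elements_mat A \<subseteq> {0, 1}"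
    then show "\<forall>i<k. \<forall>j<n. A $$ (i, j) = 0 \<or> A $$ (i, j) = 1"
      using elements_matI[OF A _ _ refl] by blast
  next
    assume entries: "\<forall>i<k. \<forall>j<n. A $$ (i, j) = 0 \<or> A $$ (i, j) = 1"
    show "elements_mat A \<subseteq> {0, 1}"
    proof
      fix a assume "a \<in> elements_mat A"
      from elements_matD[OF this] obtain i j where "i < k" "j < n" "a = A $$ (i, j)"
        using A by auto
      then show "a \<in> {0, 1}"
        using entries by simp
    qed
  qed
  then show ?thesis
    unfolding zero_one_matrices_def by blast
qed

text \<open>
  Over 0 and 1, a submatrix is \<open>J\<close> or \<open>O\<close> as soon as its four entries agree. In this form the
  condition does not mention the values, so that it survives transposition and the reading of
  entries as truth values.
\<close>

lemma avoiding_matrices_iff: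
  "A \<in> avoiding_matrices k n \<longleftrightarrow> A \<in> zero_one_matrices k n \<and>
    (\<forall>i1 i2 j1 j2. i1 < i2 \<longrightarrow> i2 < k \<longrightarrow> j1 < j2 \<longrightarrow> j2 < n \<longrightarrow>
      \<not> (A $$ (i1, j1) = A $$ (i2, j1) \<and> A $$ (i1, j2) = A $$ (i1, j1) \<and> A $$ (i2, j2) = A $$ (i1, j1)))"
    (is "_ \<longleftrightarrow> _ \<and> ?no_const")
proof (cases "A \<in> zero_one_matrices k n")
  case True
  then have dims: "dim_row A = k" "dim_col A = n"
    and entries: "\<And>i j. i < k \<Longrightarrow> j < n \<Longrightarrow> A $$ (i, j) = 0 \<or> A $$ (i, j) = 1"
    by (auto simp: zero_one_matrices_iff)
  have has: "has_2x2_submatrix A (mat 2 2 (\<lambda>_. c)) \<longleftrightarrow>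
      (\<exists>i1 i2 j1 j2. i1 < i2 \<and> i2 < k \<and> j1 < j2 \<and> j2 < n \<and>
        A $$ (i1, j1) = c \<and> A $$ (i2, j1) = c \<and> A $$ (i1, j2) = c \<and> A $$ (i2, j2) = c)" for c
    unfolding has_2x2_submatrix_def dims by (simp add: submatrix_eq_const_iff dims cong: conj_cong)
  have "(\<not> has_2x2_submatrix A J_mat \<and> \<not> has_2x2_submatrix A O_mat) \<longleftrightarrow> ?no_const"
  proof
    assume avoids: "\<not> has_2x2_submatrix A J_mat \<and> \<not> has_2x2_submatrix A O_mat"
    show ?no_const
    proof (intro allI impI)
      fix i1 i2 j1 j2
      assume less: "i1 < i2" "i2 < k" "j1 < j2" "j2 < n"
      then have "A $$ (i1, j1) = 0 \<or> A $$ (i1, j1) = 1"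
        using entries by simp
      then show "\<not> (A $$ (i1, j1) = A $$ (i2, j1) \<and> A $$ (i1, j2) = A $$ (i1, j1) \<and>
          A $$ (i2, j2) = A $$ (i1, j1))"
        using avoids less unfolding J_mat_def O_mat_def has by metis
    qed
  next
    assume no: ?no_const
    have "\<not> has_2x2_submatrix A (mat 2 2 (\<lambda>_. c))" for c
      unfolding has
    proof (intro notI, elim exE conjE)
      fix i1 i2 j1 j2
      assume "i1 < i2" "i2 < k" "j1 < j2" "j2 < n"
      from no[rule_format, OF this]
      show "A $$ (i1, j1) = c \<Longrightarrow> A $$ (i2, j1) = c \<Longrightarrow> A $$ (i1, j2) = c \<Longrightarrow>
          A $$ (i2, j2) = c \<Longrightarrow> False"
        by simp
    qed
    then show "\<not> has_2x2_submatrix A J_mat \<and> \<not> has_2x2_submatrix A O_mat"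
      unfolding J_mat_def O_mat_def by blast
  qed
  then show ?thesis using True by simp
qed simp

lemma transpose_avoiding:
  assumes "A \<in> avoiding_matrices k n"
  shows "transpose_mat A \<in> avoiding_matrices n k"
proof -
  have 01: "A \<in> zero_one_matrices k n" and
    no: "\<And>i1 i2 j1 j2. i1 < i2 \<Longrightarrow> i2 < k \<Longrightarrow> j1 < j2 \<Longrightarrow> j2 < n \<Longrightarrow>
      \<not> (A $$ (i1, j1) = A $$ (i2, j1) \<and> A $$ (i1, j2) = A $$ (i1, j1) \<and> A $$ (i2, j2) = A $$ (i1, j1))"
    using assms unfolding avoiding_matrices_iff by blast+
  have A: "A \<in> carrier_mat k n"
    using 01 by (simp add: zero_one_matrices_iff)
  have entry: "transpose_mat A $$ (j, i) = A $$ (i, j)" if "i < k" "j < n" for i j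
    using that A by simp
  have zero_one: "transpose_mat A \<in> zero_one_matrices n k"
    using 01 entry A by (auto simp: zero_one_matrices_iff)
  have "\<not> (transpose_mat A $$ (j1, i1) = transpose_mat A $$ (j2, i1) \<and>
      transpose_mat A $$ (j1, i2) = transpose_mat A $$ (j1, i1) \<and>
      transpose_mat A $$ (j2, i2) = transpose_mat A $$ (j1, i1))"
    if "j1 < j2" "j2 < n" "i1 < i2" "i2 < k" for i1 i2 j1 j2
  proof -
    have "i1 < k" "j1 < n"
      using that by simp_all
    then show ?thesis
      using no[OF that(3,4,1,2)] that by (auto simp: entry)
  qed
  then show ?thesis
    using zero_one unfolding avoiding_matrices_iff by simp
qed

lemma phi_commute: "phi k n J_mat O_mat = phi n k J_mat O_mat"
proof -
  have "transpose_mat ` avoiding_matrices k n \<subseteq> avoiding_matrices n k" for k n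
    by (rule image_subsetI) (rule transpose_avoiding)
  then have "bij_betw transpose_mat (avoiding_matrices k n) (avoiding_matrices n k)"
    by (intro bij_betw_byWitness[where f' = transpose_mat] ballI transpose_transpose)
  then show ?thesis
    unfolding phi_def by (rule bij_betw_same_card)
qed

lemma avoiding_matrices_bij_columns:
  "bij_betw (\<lambda>A. map (\<lambda>j. map (\<lambda>i. A $$ (i, j) = 1) [0..<k]) [0..<n])
    (avoiding_matrices k n)
    {cs. length cs = n \<and> set cs \<subseteq> {c. length c = k} \<and> sorted_wrt compatible cs}"
    (is "bij_betw ?f ?M ?C")
proof (rule bij_betw_byWitness[where f' = "\<lambda>cs. mat k n (\<lambda>(i, j). of_bool (cs ! j ! i))"])
  let ?g = "\<lambda>cs. mat k n (\<lambda>(i, j). of_bool (cs ! j ! i)) :: nat mat"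
  show "\<forall>A\<in>?M. ?g (?f A) = A"
  proof
    fix A assume "A \<in> ?M"
    then have "A \<in> zero_one_matrices k n" by simp
    then have A: "A \<in> carrier_mat k n"
      and entries: "\<And>i j. i < k \<Longrightarrow> j < n \<Longrightarrow> A $$ (i, j) = 0 \<or> A $$ (i, j) = 1"
      by (auto simp: zero_one_matrices_iff)
    have "?g (?f A) $$ (i, j) = A $$ (i, j)" if "i < k" "j < n" for i j
      using entries[OF that] that by auto
    then show "?g (?f A) = A"
      using A by (intro eq_matI) simp_all
  qed
  show "\<forall>cs\<in>?C. ?f (?g cs) = cs"
  proof
    fix cs assume "cs \<in> ?C"
    then have len: "length cs = n" and "\<And>j. j < n \<Longrightarrow> length (cs ! j) = k"
      by (auto dest: nth_mem)
    then have "?f (?g cs) ! j = cs ! j" if "j < n" for j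
      using that by (intro nth_equalityI) simp_all
    then show "?f (?g cs) = cs"
      using len by (intro nth_equalityI) simp_all
  qed
  show "?f ` ?M \<subseteq> ?C"
  proof (rule image_subsetI)
    fix A assume "A \<in> ?M"
    then have A01: "A \<in> zero_one_matrices k n" and
      no: "\<And>i1 i2 j1 j2. i1 < i2 \<Longrightarrow> i2 < k \<Longrightarrow> j1 < j2 \<Longrightarrow> j2 < n \<Longrightarrow>
        \<not> (A $$ (i1, j1) = A $$ (i2, j1) \<and> A $$ (i1, j2) = A $$ (i1, j1) \<and> A $$ (i2, j2) = A $$ (i1, j1))"
      unfolding avoiding_matrices_iff by blast+
    have entries: "A $$ (i, j) = 0 \<or> A $$ (i, j) = 1" if "i < k" "j < n" for i j
      using A01 that by (simp add: zero_one_matrices_iff)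
    have eq_iff: "(A $$ (i, j) = 1) = (A $$ (i', j') = 1) \<longleftrightarrow> A $$ (i, j) = A $$ (i', j')"
      if "i < k" "j < n" "i' < k" "j' < n" for i j i' j'
      using entries[OF that(1,2)] entries[OF that(3,4)] by auto
    have "compatible (?f A ! j1) (?f A ! j2)" if "j1 < j2" "j2 < n" for j1 j2
    proof (subst compatible_iff[of _ k], goal_cases)
      case 3
      have "\<not> ((A $$ (i1, j1) = 1) = (A $$ (i2, j1) = 1) \<and> (A $$ (i1, j2) = 1) = (A $$ (i1, j1) = 1)
          \<and> (A $$ (i2, j2) = 1) = (A $$ (i1, j1) = 1))" if "i1 < i2" "i2 < k" for i1 i2
      proof -
        have less: "i1 < k" "j1 < n"
          using that \<open>j1 < j2\<close> \<open>j2 < n\<close> by simp_all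
        show ?thesis
          using no[OF that \<open>j1 < j2\<close> \<open>j2 < n\<close>]
          unfolding eq_iff[OF less that(2) less(2)] eq_iff[OF less(1) \<open>j2 < n\<close> less]
            eq_iff[OF that(2) \<open>j2 < n\<close> less] .
      qed
      then show ?case using that by simp
    qed (use that in simp_all)
    then have "sorted_wrt compatible (?f A)"
      unfolding sorted_wrt_iff_nth_less by simp
    then show "?f A \<in> ?C" by auto
  qed
  show "?g ` ?C \<subseteq> ?M"
  proof (rule image_subsetI)
    fix cs assume cs: "cs \<in> ?C"
    have comp: "\<not> (cs ! j1 ! i1 = cs ! j1 ! i2 \<and> cs ! j2 ! i1 = cs ! j1 ! i1 \<and> cs ! j2 ! i2 = cs ! j1 ! i1)"
      if "i1 < i2" "i2 < k" "j1 < j2" "j2 < n" for i1 i2 j1 j2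
    proof -
      have "length c = k" if "c \<in> set cs" for c
        using cs that by auto
      from this[OF nth_mem] have "length (cs ! j1) = k" "length (cs ! j2) = k"
        using cs that by simp_all
      moreover have "compatible (cs ! j1) (cs ! j2)"
        using cs that by (auto simp: sorted_wrt_iff_nth_less)
      ultimately show ?thesis
        using compatible_iff[of "cs ! j1" k "cs ! j2"] that by simp
    qed
    have zero_one: "?g cs \<in> zero_one_matrices k n"
      by (simp add: zero_one_matrices_iff)
    have "\<not> (?g cs $$ (i1, j1) = ?g cs $$ (i2, j1) \<and> ?g cs $$ (i1, j2) = ?g cs $$ (i1, j1)
        \<and> ?g cs $$ (i2, j2) = ?g cs $$ (i1, j1))"
      if "i1 < i2" "i2 < k" "j1 < j2" "j2 < n" for i1 i2 j1 j2
      using comp[OF that] that by (simp add: of_bool_eq_iff)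
    then show "?g cs \<in> ?M"
      using zero_one unfolding avoiding_matrices_iff by simp
  qed
qed

abbreviation columns :: "nat \<Rightarrow> bool list list" where
  "columns k \<equiv> List.n_lists k [False, True]"

lemma distinct_columns: "distinct (columns k)"
  by (rule distinct_n_lists) simp

lemma set_columns: "set (columns k) = {c. length c = k}"
  by (auto simp: set_n_lists)

lemma phi_eq_count_seqs: "phi k n J_mat O_mat = count_seqs compatible n (columns k)"
  using bij_betw_same_card[OF avoiding_matrices_bij_columns]
    card_sorted_wrt_eq_count_seqs[OF distinct_columns]
  unfolding phi_def set_columns by metis

lemma phi_eq_0_mono:
  assumes "phi k0 n0 J_mat O_mat = 0" "k0 \<le> k" "n0 \<le> n"
  shows "phi k n J_mat O_mat = 0"
proof -
  have "phi k0 n J_mat O_mat = 0"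
    using assms count_seqs_eq_0_mono[OF distinct_columns] unfolding phi_eq_count_seqs by blast
  then have "phi n k0 J_mat O_mat = 0"
    by (simp add: phi_commute)
  then have "phi n k J_mat O_mat = 0"
    using assms count_seqs_eq_0_mono[OF distinct_columns] unfolding phi_eq_count_seqs by blast
  then show ?thesis
    by (simp add: phi_commute)
qed

section \<open>Heights 1 and 2\<close>

lemma columns_1: "columns 1 = [[False], [True]]"
  by simp

lemma columns_2: "columns 2 = [[False, False], [True, False], [False, True], [True, True]]"
  by (simp add: numeral_2_eq_2)

lemma compatible_height_1: "compatible [a] [b]"
  by (simp add: compatible_def)

lemma compatible_height_2: "compatible [a, b] [c, d] \<longleftrightarrow> \<not> (a = b \<and> c = a \<and> d = a)"
  by (cases a; cases b; cases c; cases d) (simp_all add: compatible_def all_bool_eq)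

lemma phi_1: "phi 1 n J_mat O_mat = 2 ^ n"
  unfolding phi_eq_count_seqs columns_1
  by (induction n) (simp_all add: compatible_height_1)

lemma count_mixed: "count_seqs compatible n [[True, False], [False, True]] = 2 ^ n"
  by (induction n) (simp_all add: compatible_height_2)

text \<open>
  With one constant column among the candidates, it occurs nowhere or at one of \<open>n\<close> places.
  Multiplying by powers of 2, here and below, keeps the exponents of \<open>n 2^(n-1)\<close> and
  \<open>n (n-1) 2^(n-2)\<close> natural at small \<open>n\<close>.
\<close>

lemma count_mixed_and_zero:
  "2 * count_seqs compatible n [[False, False], [True, False], [False, True]] = (n + 2) * 2 ^ n"
  by (induction n) (simp_all add: compatible_height_2 count_mixed algebra_simps)

lemma count_mixed_and_one:
  "2 * count_seqs compatible n [[True, False], [False, True], [True, True]] = (n + 2) * 2 ^ n"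
  by (induction n) (simp_all add: compatible_height_2 count_mixed algebra_simps)

lemma four_phi_2: "4 * phi 2 n J_mat O_mat = (n ^ 2 + 3 * n + 4) * 2 ^ n"
  unfolding phi_eq_count_seqs columns_2
proof (induction n)
  case (Suc n)
  then show ?case
    using count_mixed_and_zero[of n] count_mixed_and_one[of n]
    by (simp add: compatible_height_2 algebra_simps power2_eq_square)
qed simp

lemma phi_2: "real (phi 2 n J_mat O_mat) = (real n ^ 2 + 3 * real n + 4) * 2 powi (int n - 2)"
proof -
  have "4 * real (phi 2 n J_mat O_mat) = real (4 * phi 2 n J_mat O_mat)"
    by simp
  also have "\<dots> = (real n ^ 2 + 3 * real n + 4) * 2 ^ n"
    unfolding four_phi_2 by simp
  finally show ?thesis
    by (simp add: power_int_diff)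
qed

section \<open>Heights 3 to 5\<close>

text \<open>
  For three rows the positive values can be read off: the six non-constant columns are pairwise compatible,
  and 111 is compatible only with 000 and the three columns with two zeros, dually for 000. So
  \<open>n \<ge> 3\<close> columns form \<open>6!/(6-n)!\<close> sequences without and \<open>2 n \<cdot> 3!/(4-n)!\<close> (0 for \<open>n > 4\<close>) with a
  constant column. For four rows, six columns can only be the six balanced ones, in any order.
\<close>

lemma phi_3_values:
  "phi 3 3 J_mat O_mat = 156" "phi 3 4 J_mat O_mat = 408"
  "phi 3 5 J_mat O_mat = 720" "phi 3 6 J_mat O_mat = 720" "phi 3 7 J_mat O_mat = 0"
  unfolding phi_eq_count_seqs by code_simp+

lemma phi_4_values:
  "phi 4 4 J_mat O_mat = 840" "phi 4 5 J_mat O_mat = 720" "phi 4 6 J_mat O_mat = 720"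
  unfolding phi_eq_count_seqs by code_simp+

lemma phi_5_5: "phi 5 5 J_mat O_mat = 0"
  unfolding phi_eq_count_seqs by code_simp

theorem mainTheorem10:
  shows "(\<forall>k n. k \<ge> 1 \<longrightarrow> n \<ge> 1 \<longrightarrow> phi k n J_mat O_mat = phi n k J_mat O_mat)
    \<and> ((\<forall>n\<ge>1. phi 1 n J_mat O_mat = 2 ^ n)
      \<and> (\<forall>n\<ge>1. real (phi 2 n J_mat O_mat)
            = (real n ^ 2 + 3 * real n + 4) * 2 powi (int n - 2)))
    \<and> (phi 3 3 J_mat O_mat = 156
      \<and> phi 3 4 J_mat O_mat = 408
      \<and> phi 4 4 J_mat O_mat = 840
      \<and> phi 3 5 J_mat O_mat = 720
      \<and> phi 3 6 J_mat O_mat = 720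
      \<and> phi 4 5 J_mat O_mat = 720
      \<and> phi 4 6 J_mat O_mat = 720)
    \<and> ((\<forall>k n. k \<ge> 5 \<longrightarrow> n \<ge> 5 \<longrightarrow> phi k n J_mat O_mat = 0)
      \<and> (\<forall>n\<ge>7. phi 3 n J_mat O_mat = 0 \<and> phi 4 n J_mat O_mat = 0)
      \<and> (\<forall>n\<ge>5. phi 5 n J_mat O_mat = 0 \<and> phi 6 n J_mat O_mat = 0)
      \<and> (\<forall>k n. k \<ge> 7 \<longrightarrow> n \<ge> 3 \<longrightarrow> phi k n J_mat O_mat = 0))"
proof -
  have zero_3_7: "phi k n J_mat O_mat = 0" if "3 \<le> k" "7 \<le> n" for k n
    using phi_eq_0_mono[OF phi_3_values(5) that] .
  have zero_7_3: "phi k n J_mat O_mat = 0" if "7 \<le> k" "3 \<le> n" for k n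
    using zero_3_7[OF that(2,1)] phi_commute[of k n] by simp
  have zero_5_5: "phi k n J_mat O_mat = 0" if "5 \<le> k" "5 \<le> n" for k n
    using phi_eq_0_mono[OF phi_5_5 that] .
  show ?thesis
    using phi_commute phi_1 phi_2 phi_3_values phi_4_values zero_3_7 zero_7_3 zero_5_5
    by (intro conjI allI impI; simp)
qed

end
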